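(* Let $X_1,\ldots,X_n\in\mathfrak{X}$ and $Y_1,\ldots,Y_n\in\mathbb{R}$, and consider the positive semidefinite quadratic program $$\begin{array}{rl}\min&\sum_{k=1}^n|Y_k-z^k|^2\\ \text{subject to}&\langle\xi_k,X_j-X_k\rangle\le z^j-z^k\quad\forall k,j=1,\ldots,n,\\ &\xi_1,\ldots,\xi_n\in\mathbb{R}^d,\ z\in\mathbb{R}^n.\end{array}$$ This program has a unique solution $Z_n$ in $z$, i.e. for any two solutions $(\xi_1,\ldots,\xi_n,z)$ and $(\tau_1,\ldots,\tau_n,\zeta)$ one has $z=\zeta=Z_n$. This $Z_n$ is the only vector in $\mathbb{R}^n$ satisfying $$Z_n=\operatorname*{argmin}_{z\in\mathcal{K}_{\mathcal{X}}}\left\{\sum_{k=1}^n|Y_k-z^k|^2\right\}.$$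
   Context: $\mathfrak{X}\subset\mathbb{R}^d$ ($d\ge1$) is a closed convex set with nonempty interior, and $\mathcal{X}=\{X_1,\ldots,X_n\}\subset\mathfrak{X}$. $\mathcal{K}_{\mathcal{X}}$ is the set of all $z=(z^1,\ldots,z^n)\in\mathbb{R}^n$ for which there is a convex function $\psi:\mathfrak{X}\to\mathbb{R}$ with $\psi(X_j)=z^j$ for all $j=1,\ldots,n$. Upper indices denote components of vectors. *)

theory Defs
  imports "HOL-Analysis.Analysis"
begin

text \<open>
  Points, subgradients and observations are families over a finite index type \<open>'n\<close>
  with \<open>n = CARD('n)\<close>. The points need not be pairwise distinct.
\<close>

definition convex_values :: "(real^'d) set \<Rightarrow> ('n::finite \<Rightarrow> real^'d) \<Rightarrow> (real^'n) set" where
  "convex_values \<XX> X = {z. \<exists>\<psi>. convex_on \<XX> \<psi> \<and> (\<forall>j. \<psi> (X j) = z $ j)}"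

definition sq_error :: "('n::finite \<Rightarrow> real) \<Rightarrow> real^'n \<Rightarrow> real" where
  "sq_error Y z = (\<Sum>k\<in>UNIV. \<bar>Y k - z $ k\<bar>\<^sup>2)"

definition qp_feasible ::
    "('n::finite \<Rightarrow> real^'d) \<Rightarrow> (('n \<Rightarrow> real^'d) \<times> (real^'n)) set" where
  "qp_feasible X = {(\<xi>, z). \<forall>k j. \<xi> k \<bullet> (X j - X k) \<le> z $ j - z $ k}"

text \<open>A solution is a feasible point at which the minimum is attained.\<close>

definition qp_solution ::
    "('n::finite \<Rightarrow> real^'d) \<Rightarrow> ('n \<Rightarrow> real) \<Rightarrow> ('n \<Rightarrow> real^'d) \<times> (real^'n) \<Rightarrow> bool" where
  "qp_solution X Y = is_arg_min (\<lambda>(\<xi>, z). sq_error Y z) (\<lambda>p. p \<in> qp_feasible X)"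

end

theory Submission
  imports Defs
begin

text \<open>
  By Farkas' lemma, a subgradient \<open>\<xi>\<^sub>k\<close> at \<open>X\<^sub>k\<close> exists iff no nonnegative combination of the
  inequalities it has to satisfy is contradictory. Jensen's inequality excludes such a combination
  when \<open>z\<close> consists of values of a convex function; this also covers points on the boundary of the
  domain, where that function itself need not have a subgradient. Conversely, the maximum of the affine
  functions given by feasible \<open>\<xi>\<close> and \<open>z\<close> is convex and interpolates \<open>z\<close>. So \<open>convex_values\<close> is the
  projection of the feasible set to \<open>z\<close>. Farkas' lemma also shows that this projection is an
  intersection of closed half-spaces, and \<open>Z\<close> is the point of it closest to \<open>Y\<close>.
\<close>

text \<open>Farkas' lemma. If no nonnegative weights give a contradiction, \<open>(0, -1)\<close>
  lies outside the closed cone generated by \<open>(0, 1)\<close> and the pairs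
  \<open>(a j, b j)\<close>. A separating normal \<open>(u, t)\<close> has \<open>t > 0\<close>, and
  \<open>- u / t\<close> solves the system.\<close>

lemma farkas_inner_le:
  fixes a :: "'n::finite \<Rightarrow> 'a::euclidean_space" and b :: "'n \<Rightarrow> real"
  shows "(\<exists>\<xi>. \<forall>j. \<xi> \<bullet> a j \<le> b j) \<longleftrightarrow>
    (\<forall>l. (\<forall>j. 0 \<le> l j) \<longrightarrow> (\<Sum>j\<in>UNIV. l j *\<^sub>R a j) = 0 \<longrightarrow> 0 \<le> (\<Sum>j\<in>UNIV. l j * b j))"
    (is "?L \<longleftrightarrow> ?R")
proof
  assume ?L
  then obtain \<xi> where \<xi>: "\<And>j. \<xi> \<bullet> a j \<le> b j"
    by blast
  show ?R
  proof (intro allI impI)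
    fix l :: "'n \<Rightarrow> real"
    assume l: "\<forall>j. 0 \<le> l j" and l0: "(\<Sum>j\<in>UNIV. l j *\<^sub>R a j) = 0"
    have "0 = (\<Sum>j\<in>UNIV. l j * (\<xi> \<bullet> a j))"
      using arg_cong[OF l0, of "inner \<xi>"] by (simp add: inner_sum_right)
    also have "\<dots> \<le> (\<Sum>j\<in>UNIV. l j * b j)"
      using l \<xi> by (intro sum_mono mult_left_mono) auto
    finally show "0 \<le> (\<Sum>j\<in>UNIV. l j * b j)" .
  qed
next
  assume R: ?R
  define G where "G = insert (0, 1) (range (\<lambda>j. (a j, b j)))"
  define C where "C = convex_cone hull G"
  \<comment> \<open>\<open>C\<close> is finitely generated, hence closed, while \<open>E\<close>
    displays the multipliers that the assumption speaks about. The inclusion of \<open>C\<close> in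
    \<open>E\<close> is enough to transfer the exclusion of \<open>(0, -1)\<close>.\<close>
  define E where "E = {(\<Sum>j\<in>UNIV. l j *\<^sub>R a j, s) | l s.
    (\<forall>j. 0 \<le> l j) \<and> (\<Sum>j\<in>UNIV. l j * b j) \<le> s}"
  have GE: "G \<subseteq> E"
  proof
    fix p assume "p \<in> G"
    then consider "p = (0, 1)" | i where "p = (a i, b i)"
      by (auto simp: G_def)
    then show "p \<in> E"
    proof cases
      case 1
      then show ?thesis
        by (auto simp: E_def intro!: exI[of _ "\<lambda>_. 0"])
    next
      case 2
      \<comment> \<open>A single generator is the combination with unit weight at \<open>i\<close>;
        the conditional form makes \<open>sum.delta\<close> applicable.\<close>
      have "of_bool (j = i) *\<^sub>R a j = (if j = i then a j else 0)"
        "of_bool (j = i) * b j = (if j = i then b j else 0)" for j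
        by simp_all
      then have "(\<Sum>j\<in>UNIV. of_bool (j = i) *\<^sub>R a j) = a i" "(\<Sum>j\<in>UNIV. of_bool (j = i) * b j) = b i"
        by (simp_all only: sum.delta finite_class.finite) simp_all
      then show ?thesis
        unfolding E_def 2 by (intro CollectI exI[of _ "\<lambda>j. of_bool (j = i)"] exI[of _ "b i"]) auto
    qed
  qed
  have "convex_cone E"
    unfolding convex_cone_iff
  proof (intro conjI ballI allI impI)
    show "0 \<in> E"
      by (auto simp: E_def zero_prod_def intro!: exI[of _ "\<lambda>_. 0"])
  next
    fix x y assume "x \<in> E" "y \<in> E"
    then obtain l s m t where
      x: "x = (\<Sum>j\<in>UNIV. l j *\<^sub>R a j, s)" "\<forall>j. 0 \<le> l j" "(\<Sum>j\<in>UNIV. l j * b j) \<le> s" and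
      y: "y = (\<Sum>j\<in>UNIV. m j *\<^sub>R a j, t)" "\<forall>j. 0 \<le> m j" "(\<Sum>j\<in>UNIV. m j * b j) \<le> t"
      unfolding E_def by blast
    then show "x + y \<in> E"
      unfolding E_def
      by (intro CollectI exI[of _ "\<lambda>j. l j + m j"] exI[of _ "s + t"])
        (auto simp: sum.distrib algebra_simps)
  next
    fix x and c :: real assume "x \<in> E" "0 \<le> c"
    then obtain l s where
      x: "x = (\<Sum>j\<in>UNIV. l j *\<^sub>R a j, s)" "\<forall>j. 0 \<le> l j" "(\<Sum>j\<in>UNIV. l j * b j) \<le> s"
      unfolding E_def by blast
    have "c * (\<Sum>j\<in>UNIV. l j * b j) \<le> c * s"
      using x \<open>0 \<le> c\<close> by (simp add: mult_left_mono)
    then show "c *\<^sub>R x \<in> E"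
      unfolding E_def using x \<open>0 \<le> c\<close>
      by (intro CollectI exI[of _ "\<lambda>j. c * l j"] exI[of _ "c * s"])
        (auto simp: sum_distrib_left scaleR_sum_right mult.assoc)
  qed
  then have "C \<subseteq> E"
    unfolding C_def using GE by (simp add: hull_minimal)
  moreover have "(0, -1) \<notin> E"
  proof
    assume "(0, -1) \<in> E"
    then obtain l where "\<forall>j. 0 \<le> l j" "(\<Sum>j\<in>UNIV. l j *\<^sub>R a j) = 0" "(\<Sum>j\<in>UNIV. l j * b j) \<le> -1"
      unfolding E_def by auto
    then show False
      using R[rule_format, of l] by simp
  qed
  ultimately have notin: "(0, -1) \<notin> C"
    by blast
  have cone: "convex_cone C"
    by (simp add: C_def convex_cone_convex_cone_hull)
  have "closed C"
    by (simp add: C_def G_def closed_convex_cone_hull)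
  with cone notin obtain p \<beta> where p: "p \<bullet> (0, -1) < \<beta>" "\<And>x. x \<in> C \<Longrightarrow> \<beta> < p \<bullet> x"
    using separating_hyperplane_closed_point[of C "(0, -1)"] unfolding convex_cone_def by blast
  obtain u t where ut: "p = (u, t)"
    by force
  have "\<beta> < 0"
    using p(2)[of 0] cone by (simp add: convex_cone_iff)
  \<comment> \<open>A point of the cone with negative inner product could be rescaled so that its
    inner product is exactly \<open>\<beta>\<close>, against strict separation.\<close>
  have nonneg: "0 \<le> p \<bullet> x" if "x \<in> C" for x
  proof (rule ccontr)
    assume "\<not> 0 \<le> p \<bullet> x"
    then have "0 \<le> \<beta> / (p \<bullet> x)" "\<beta> / (p \<bullet> x) * (p \<bullet> x) = \<beta>"
      using \<open>\<beta> < 0\<close> by (auto simp: divide_nonpos_neg)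
    moreover have "(\<beta> / (p \<bullet> x)) *\<^sub>R x \<in> C"
      using cone that calculation(1) by (simp add: convex_cone_iff)
    ultimately show False
      using p(2)[of "(\<beta> / (p \<bullet> x)) *\<^sub>R x"] by simp
  qed
  have "0 < t"
    using p(1) \<open>\<beta> < 0\<close> by (simp add: ut)
  show ?L
  proof (intro exI allI)
    fix j
    have "(a j, b j) \<in> C"
      unfolding C_def by (rule hull_inc) (simp add: G_def)
    then have "0 \<le> u \<bullet> a j + t * b j"
      using nonneg[of "(a j, b j)"] by (simp add: ut)
    then show "(- (1 / t) *\<^sub>R u) \<bullet> a j \<le> b j"
      using \<open>0 < t\<close> by (simp add: field_simps)
  qed
qed

text \<open>For fixed \<open>z\<close> the constraints on different \<open>\<xi> k\<close> are
  independent, so Farkas' lemma applies to each \<open>k\<close> separately. This eliminates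
  \<open>\<xi>\<close> and leaves conditions linear in \<open>z\<close>.\<close>

lemma qp_feasible_iff_weights:
  fixes X :: "'n::finite \<Rightarrow> real^'d"
  shows "(\<exists>\<xi>. (\<xi>, z) \<in> qp_feasible X) \<longleftrightarrow>
    (\<forall>k l. (\<forall>j. 0 \<le> l j) \<longrightarrow> (\<Sum>j\<in>UNIV. l j *\<^sub>R (X j - X k)) = 0 \<longrightarrow>
      0 \<le> (\<Sum>j\<in>UNIV. l j * (z $ j - z $ k)))"
proof -
  have "(\<exists>\<xi>. (\<xi>, z) \<in> qp_feasible X) \<longleftrightarrow> (\<forall>k. \<exists>\<xi>. \<forall>j. \<xi> \<bullet> (X j - X k) \<le> z $ j - z $ k)"
    by (simp add: qp_feasible_def choice_iff)
  then show ?thesis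
    by (simp add: farkas_inner_le)
qed

lemma convex_on_Max_image:
  assumes "finite I" "I \<noteq> {}" "\<And>i. i \<in> I \<Longrightarrow> convex_on S (f i)"
  shows "convex_on S (\<lambda>x. Max ((\<lambda>i. f i x) ` I))"
proof (rule convex_onI)
  show "convex S"
    using assms convex_on_imp_convex by blast
next
  fix t :: real and x y
  assume t: "0 < t" "t < 1" and xy: "x \<in> S" "y \<in> S"
  have "f i ((1 - t) *\<^sub>R x + t *\<^sub>R y)
      \<le> (1 - t) * Max ((\<lambda>i. f i x) ` I) + t * Max ((\<lambda>i. f i y) ` I)" if "i \<in> I" for i
  proof -
    have "f i ((1 - t) *\<^sub>R x + t *\<^sub>R y) \<le> (1 - t) * f i x + t * f i y"
      using convex_onD[OF assms(3)[OF that]] t xy by simp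
    also have "\<dots> \<le> (1 - t) * Max ((\<lambda>i. f i x) ` I) + t * Max ((\<lambda>i. f i y) ` I)"
      using assms(1) that t by (intro add_mono mult_left_mono Max_ge) auto
    finally show ?thesis .
  qed
  then show "Max ((\<lambda>i. f i ((1 - t) *\<^sub>R x + t *\<^sub>R y)) ` I)
      \<le> (1 - t) * Max ((\<lambda>i. f i x) ` I) + t * Max ((\<lambda>i. f i y) ` I)"
    using assms by simp
qed

lemma convex_values_eq_feasible:
  fixes X :: "'n::finite \<Rightarrow> real^'d"
  assumes "convex \<XX>" and X: "\<And>k. X k \<in> \<XX>"
  shows "convex_values \<XX> X = {z. \<exists>\<xi>. (\<xi>, z) \<in> qp_feasible X}"
proof (intro set_eqI iffI)
  fix z :: "real^'n"
  assume "z \<in> convex_values \<XX> X"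
  then obtain \<psi> where \<psi>: "convex_on \<XX> \<psi>" "\<And>j. \<psi> (X j) = z $ j"
    by (auto simp: convex_values_def)
  have "0 \<le> (\<Sum>j\<in>UNIV. l j * (z $ j - z $ k))"
    if l: "\<forall>j. 0 \<le> l j" and l0: "(\<Sum>j\<in>UNIV. l j *\<^sub>R (X j - X k)) = 0" for k l
  proof -
    \<comment> \<open>Dividing by the total weight \<open>L\<close> turns the vanishing combination
      into a representation of \<open>X k\<close> as a convex combination of the points, ready for
      Jensen's inequality.\<close>
    define L where "L = (\<Sum>j\<in>UNIV. l j)"
    have "0 \<le> L"
      using l by (simp add: L_def sum_nonneg)
    show ?thesis
    proof (cases "L = 0")
      case True
      then have "l j = 0" for j
        using l by (simp add: L_def sum_nonneg_eq_0_iff)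
      then show ?thesis
        by simp
    next
      case False
      with \<open>0 \<le> L\<close> have "0 < L"
        by simp
      have sumX: "(\<Sum>j\<in>UNIV. l j *\<^sub>R X j) = L *\<^sub>R X k"
        using l0 by (simp add: L_def scaleR_diff_right sum_subtractf scaleR_sum_left)
      have "(\<Sum>j\<in>UNIV. (l j / L) *\<^sub>R X j) = (1 / L) *\<^sub>R (\<Sum>j\<in>UNIV. l j *\<^sub>R X j)"
        by (simp add: scaleR_sum_right)
      also have "\<dots> = X k"
        using \<open>0 < L\<close> by (simp add: sumX)
      finally have "z $ k = \<psi> (\<Sum>j\<in>UNIV. (l j / L) *\<^sub>R X j)"
        by (simp add: \<psi>)
      also have "\<dots> \<le> (\<Sum>j\<in>UNIV. (l j / L) * \<psi> (X j))"
        using \<psi>(1) l X \<open>0 < L\<close>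
        by (intro convex_on_sum) (auto simp: L_def simp flip: sum_divide_distrib)
      also have "\<dots> = (\<Sum>j\<in>UNIV. l j * z $ j) / L"
        by (simp add: \<psi> sum_divide_distrib)
      finally have "L * z $ k \<le> (\<Sum>j\<in>UNIV. l j * z $ j)"
        using \<open>0 < L\<close> by (simp add: field_simps)
      then show ?thesis
        by (simp add: L_def right_diff_distrib sum_subtractf sum_distrib_right)
    qed
  qed
  then show "z \<in> {z. \<exists>\<xi>. (\<xi>, z) \<in> qp_feasible X}"
    by (simp add: qp_feasible_iff_weights)
next
  fix z :: "real^'n"
  assume "z \<in> {z. \<exists>\<xi>. (\<xi>, z) \<in> qp_feasible X}"
  then obtain \<xi> where \<xi>: "\<And>k j. \<xi> k \<bullet> (X j - X k) \<le> z $ j - z $ k"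
    by (auto simp: qp_feasible_def)
  define \<psi> where "\<psi> x = Max (range (\<lambda>k. z $ k + \<xi> k \<bullet> (x - X k)))" for x
  have "convex_on \<XX> (\<lambda>x. z $ k + \<xi> k \<bullet> (x - X k))" for k
    using \<open>convex \<XX>\<close> by (intro convex_onI) (auto simp: algebra_simps)
  then have "convex_on \<XX> \<psi>"
    unfolding \<psi>_def by (intro convex_on_Max_image) auto
  moreover have "\<psi> (X j) = z $ j" for j
    unfolding \<psi>_def
  \<comment> \<open>At \<open>X j\<close>, feasibility bounds every affine piece by
    \<open>z $ j\<close>, and the piece with index \<open>j\<close> attains this value.\<close>
  proof (rule Max_eqI)
    show "y \<le> z $ j" if "y \<in> range (\<lambda>k. z $ k + \<xi> k \<bullet> (X j - X k))" for y
    proof -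
      from that obtain k where "y = z $ k + \<xi> k \<bullet> (X j - X k)"
        by blast
      then show ?thesis
        using \<xi>[of k j] by simp
    qed
    show "z $ j \<in> range (\<lambda>k. z $ k + \<xi> k \<bullet> (X j - X k))"
      by (rule range_eqI[of _ _ j]) simp
  qed simp
  ultimately show "z \<in> convex_values \<XX> X"
    by (auto simp: convex_values_def)
qed

text \<open>Projections of closed sets need not be closed, so closedness is read off the description
  by weights: each pair of \<open>k\<close> and \<open>l\<close> contributes one homogeneous linear
  inequality in \<open>z\<close>.\<close>

lemma closed_convex_feasible_values:
  fixes X :: "'n::finite \<Rightarrow> real^'d"
  shows "closed {z. \<exists>\<xi>. (\<xi>, z) \<in> qp_feasible X}" "convex {z. \<exists>\<xi>. (\<xi>, z) \<in> qp_feasible X}"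
proof -
  define H where "H k l = {z :: real^'n. 0 \<le> (\<Sum>j\<in>UNIV. l j * (z $ j - z $ k))}" for k l
  define W where "W k = {l. (\<forall>j. 0 \<le> l j) \<and> (\<Sum>j\<in>UNIV. l j *\<^sub>R (X j - X k)) = 0}" for k
  have eq: "{z. \<exists>\<xi>. (\<xi>, z) \<in> qp_feasible X} = (\<Inter>k. \<Inter>l\<in>W k. H k l)"
    unfolding qp_feasible_iff_weights H_def W_def by auto
  have "closed (H k l)" for k l
    unfolding H_def by (intro closed_Collect_le continuous_intros)
  then show "closed {z. \<exists>\<xi>. (\<xi>, z) \<in> qp_feasible X}"
    unfolding eq by blast
  have "convex (H k l)" for k l
  proof -
    have "linear (\<lambda>z :: real^'n. \<Sum>j\<in>UNIV. l j * (z $ j - z $ k))"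
      by (intro linearI) (simp_all add: algebra_simps sum.distrib sum_subtractf sum_distrib_left)
    moreover have "H k l = (\<lambda>z. \<Sum>j\<in>UNIV. l j * (z $ j - z $ k)) -` {0..}"
      by (auto simp: H_def)
    ultimately show ?thesis
      by (simp add: convex_linear_vimage)
  qed
  then show "convex {z. \<exists>\<xi>. (\<xi>, z) \<in> qp_feasible X}"
    unfolding eq by (intro convex_INT)
qed

text \<open>\<open>sq_error Y z\<close> is the squared Euclidean distance from \<open>z\<close> to
  the vector of observations.\<close>

lemma sq_error_le_iff_dist:
  "sq_error Y z \<le> sq_error Y w \<longleftrightarrow> dist (vec_lambda Y) z \<le> dist (vec_lambda Y) w"
  by (simp add: sq_error_def dist_vec_def L2_set_def dist_real_def)

lemma is_arg_min_sq_error_iff_closest_point: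
  fixes K :: "(real^'n) set"
  assumes "closed K" "convex K" "K \<noteq> {}"
  shows "is_arg_min (sq_error Y) (\<lambda>z. z \<in> K) w \<longleftrightarrow> w = closest_point K (vec_lambda Y)"
  unfolding is_arg_min_linorder sq_error_le_iff_dist
  by (metis assms closest_point_unique closest_point_in_set closest_point_le)

text \<open>The objective ignores \<open>\<xi>\<close>, so minimizing over feasible pairs amounts to
  minimizing over the projection to \<open>z\<close>, with any \<open>\<xi>\<close> feasible for the
  minimizer.\<close>

lemma qp_solution_iff:
  "qp_solution X Y (\<xi>, z) \<longleftrightarrow>
    (\<xi>, z) \<in> qp_feasible X \<and> is_arg_min (sq_error Y) (\<lambda>z. z \<in> {z. \<exists>\<xi>. (\<xi>, z) \<in> qp_feasible X}) z"
  by (auto simp: qp_solution_def is_arg_min_def)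

theorem lemma2p5:
  fixes \<XX> :: "(real^'d) set"
    and X :: "'n::finite \<Rightarrow> real^'d"
    and Y :: "'n \<Rightarrow> real"
  assumes "closed \<XX>" and "convex \<XX>" and "interior \<XX> \<noteq> {}"
    and "\<And>k. X k \<in> \<XX>"
  shows "\<exists>Z :: real^'n.
      (\<exists>\<xi>. qp_solution X Y (\<xi>, Z)) \<and>
      (\<forall>\<xi> z \<tau> \<zeta>. qp_solution X Y (\<xi>, z) \<longrightarrow> qp_solution X Y (\<tau>, \<zeta>) \<longrightarrow> z = \<zeta> \<and> \<zeta> = Z) \<and>
      (\<forall>w. is_arg_min (sq_error Y) (\<lambda>z. z \<in> convex_values \<XX> X) w \<longleftrightarrow> w = Z)"
proof -
  define K where "K = {z. \<exists>\<xi>. (\<xi>, z) \<in> qp_feasible X}"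
  have "(\<lambda>_. 0, 0) \<in> qp_feasible X"
    by (simp add: qp_feasible_def)
  then have "K \<noteq> {}"
    by (auto simp: K_def)
  then have argmin: "is_arg_min (sq_error Y) (\<lambda>z. z \<in> K) w \<longleftrightarrow> w = closest_point K (vec_lambda Y)"
    for w
    using is_arg_min_sq_error_iff_closest_point closed_convex_feasible_values[of X]
    unfolding K_def by blast
  \<comment> \<open>The \<open>z\<close> component of every solution is thus the same projection
    point, whatever \<open>\<xi>\<close> accompanies it.\<close>
  have sol: "qp_solution X Y (\<xi>, z) \<longleftrightarrow>
      (\<xi>, z) \<in> qp_feasible X \<and> z = closest_point K (vec_lambda Y)" for \<xi> z
    using argmin[of z] unfolding qp_solution_iff K_def by blast
  have "closest_point K (vec_lambda Y) \<in> K"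
    using argmin[of "closest_point K (vec_lambda Y)"] by (simp add: is_arg_min_def)
  then have "\<exists>\<xi>. qp_solution X Y (\<xi>, closest_point K (vec_lambda Y))"
    unfolding sol by (simp add: K_def)
  moreover have "convex_values \<XX> X = K"
    unfolding K_def using assms by (intro convex_values_eq_feasible)
  ultimately show ?thesis
    using argmin sol by (intro exI[of _ "closest_point K (vec_lambda Y)"]) auto
qed

end
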